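(* Let $b_n = -(3n-2)$ for all integers $n \ge 1$, and let $a_1 = a_2 = 1$ and $a_n = -(n-1)(2n-5)$ for all integers $n \ge 3$. Then the following continued fraction equality holds: $$-\frac{\pi}{4} = \cfrac{a_1}{b_1 + \cfrac{a_2}{b_2 + \cfrac{a_3}{b_3 + \cfrac{a_4}{b_4 + \cfrac{a_5}{b_5 + \cdots}}}}} = \cfrac{1}{-1 + \cfrac{1}{-4 + \cfrac{-2}{-7 + \cfrac{-9}{-10 + \cfrac{-20}{-13 + \cdots}}}}}.$$ That is, the continued fraction converges and its value is $-\pi/4$: with $p_n, q_n$ the numerators and denominators of its convergents, $\lim_{n\to\infty} p_n/q_n = -\pi/4$.
   Context: For sequences $(a_n)_{n\ge1}$, $(b_n)_{n\ge1}$ of real numbers, the convergents of the generalized continued fraction $a_1/(b_1 + a_2/(b_2 + a_3/(b_3+\cdots)))$ (with no leading term $b_0$) are $p_n/q_n$, where $(p_n)_{n \ge -1}$ and $(q_n)_{n\ge -1}$ are defined by $p_{-1}=1$, $p_0=0$, $q_{-1}=0$, $q_0=1$ and $$p_n = b_n p_{n-1} + a_n p_{n-2}, \qquad q_n = b_n q_{n-1} + a_n q_{n-2}, \qquad n\ge 1.$$ The value of the continued fraction is the limit $\lim_{n\to\infty} p_n/q_n$. *)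

theory Defs
  imports Complex_Main
begin

text \<open>
  Numerators and denominators of the convergents of
  \<open>a 1 / (b 1 + a 2 / (b 2 + a 3 / (b 3 + \<dots>)))\<close>; the values \<open>a 0\<close> and \<open>b 0\<close> are never used.
  The index is a natural number, so the initial values \<open>p\<^sub>-\<^sub>1 = 1\<close> and \<open>q\<^sub>-\<^sub>1 = 0\<close> do not appear
  as function values; they are substituted into the recurrence at \<open>n = 1\<close>.
\<close>

fun gcf_num :: "(nat \<Rightarrow> real) \<Rightarrow> (nat \<Rightarrow> real) \<Rightarrow> nat \<Rightarrow> real" where
  "gcf_num a b 0 = 0"
| "gcf_num a b (Suc 0) = b 1 * gcf_num a b 0 + a 1 * 1"
| "gcf_num a b (Suc (Suc n)) =
     b (Suc (Suc n)) * gcf_num a b (Suc n) + a (Suc (Suc n)) * gcf_num a b n"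

fun gcf_den :: "(nat \<Rightarrow> real) \<Rightarrow> (nat \<Rightarrow> real) \<Rightarrow> nat \<Rightarrow> real" where
  "gcf_den a b 0 = 1"
| "gcf_den a b (Suc 0) = b 1 * gcf_den a b 0 + a 1 * 0"
| "gcf_den a b (Suc (Suc n)) =
     b (Suc (Suc n)) * gcf_den a b (Suc n) + a (Suc (Suc n)) * gcf_den a b n"

text \<open>
  Division by zero yields \<open>0\<close> in HOL, so convergence to a nonzero \<open>L\<close> already forces the
  denominators to be eventually nonzero. The side condition covers \<open>L = 0\<close> as well.
\<close>

definition gcf_has_value :: "(nat \<Rightarrow> real) \<Rightarrow> (nat \<Rightarrow> real) \<Rightarrow> real \<Rightarrow> bool" where
  "gcf_has_value a b L \<longleftrightarrow>
     (\<forall>\<^sub>F n in sequentially. gcf_den a b n \<noteq> 0) \<and>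
     (\<lambda>n. gcf_num a b n / gcf_den a b n) \<longlonglongrightarrow> L"

end

theory Submission
  imports Defs "HOL-Analysis.Analysis" "HOL-Real_Asymp.Real_Asymp"
begin

text \<open>
  The combination \<open>p\<^sub>n + (\<pi> / 4) q\<^sub>n\<close> is the minimal solution of the recurrence. With
  \<open>J m\<close> the integral of \<open>(sin x)\<^sup>2 (1 - cos x)\<^sup>m\<close> over \<open>[0, \<pi> / 2]\<close>, one has
  \<open>p\<^sub>n + (\<pi> / 4) q\<^sub>n = \<plusminus> n! ((n\<^sup>2 + n - 1) J (n - 2) - (n + 2)) / 2\<close>, since \<open>J\<close> satisfies
  a first-order recurrence with \<open>J 0 = \<pi> / 4\<close>. As \<open>J\<close> is bounded, this is \<open>n!\<close> times a
  quantity of polynomial growth, while \<open>\<bar>q\<^sub>n\<bar>\<close> is at least \<open>n!\<close> times a power of \<open>3 / 2\<close>.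
\<close>

definition sin_cos_moment :: "nat \<Rightarrow> real" where
  "sin_cos_moment m = integral {0..pi/2} (\<lambda>x. (sin x)\<^sup>2 * (1 - cos x) ^ m)"

lemma sin_cos_moment_integrable:
  "(\<lambda>x. (sin x)\<^sup>2 * (1 - cos x) ^ m) integrable_on {0..pi/2::real}"
  by (intro integrable_continuous_interval continuous_intros)

lemma sin_cos_moment_nonneg: "0 \<le> sin_cos_moment m"
  unfolding sin_cos_moment_def
  by (intro integral_nonneg sin_cos_moment_integrable) simp

text \<open>A bound uniform in \<open>m\<close>: the integrand is at most 1 and the interval has
  length \<open>pi / 2 < 2\<close>.\<close>

lemma sin_cos_moment_le_2: "sin_cos_moment m \<le> 2"
proof -
  have "sin_cos_moment m \<le> integral {0..pi/2} (\<lambda>x. 1)"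
    unfolding sin_cos_moment_def
  proof (intro integral_le sin_cos_moment_integrable)
    fix x :: real assume "x \<in> {0..pi/2}"
    then have "0 \<le> cos x"
      by (simp add: cos_ge_zero)
    then have "(1 - cos x) ^ m \<le> 1"
      by (intro power_le_one) auto
    moreover have "(sin x)\<^sup>2 \<le> 1" "0 \<le> (1 - cos x) ^ m"
      by (auto simp: abs_square_le_1)
    ultimately show "(sin x)\<^sup>2 * (1 - cos x) ^ m \<le> 1"
      by (intro mult_le_one) auto
  qed auto
  also have "\<dots> \<le> 2"
    using pi_less_4 by simp
  finally show ?thesis .
qed

text \<open>The source of the constant \<open>pi / 4\<close> in the limit;
  \<open>(x - sin x * cos x) / 2\<close> is an antiderivative.\<close>

lemma sin_cos_moment_0: "sin_cos_moment 0 = pi / 4"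
proof -
  have "((\<lambda>x. (sin x)\<^sup>2) has_integral
      (pi/2 - sin (pi/2) * cos (pi/2)) / 2 - (0 - sin 0 * cos 0) / 2) {0..pi/2::real}"
  proof (rule fundamental_theorem_of_calculus)
    fix x :: real
    have "((\<lambda>x. (x - sin x * cos x) / 2) has_real_derivative
        (1 - ((cos x)\<^sup>2 - (sin x)\<^sup>2)) / 2) (at x within {0..pi/2})"
      by (auto intro!: derivative_eq_intros simp: power2_eq_square)
    moreover have "(1 - ((cos x)\<^sup>2 - (sin x)\<^sup>2)) / 2 = (sin x)\<^sup>2"
      by (simp add: cos_squared_eq)
    ultimately show "((\<lambda>x. (x - sin x * cos x) / 2) has_vector_derivative (sin x)\<^sup>2)
        (at x within {0..pi/2})"
      by (simp add: has_real_derivative_iff_has_vector_derivative)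
  qed simp
  then show ?thesis
    by (simp add: sin_cos_moment_def integral_unique)
qed

text \<open>Integrate the derivative of \<open>(sin x)\<^sup>3 (1 - cos x)\<^sup>m\<close>.\<close>

lemma sin_cos_moment_Suc:
  "(real m + 3) * sin_cos_moment (Suc m) = (2 * real m + 3) * sin_cos_moment m - 1"
proof -
  let ?F = "\<lambda>x::real. (sin x) ^ 3 * (1 - cos x) ^ m"
  let ?f = "\<lambda>k x::real. (sin x)\<^sup>2 * (1 - cos x) ^ k"
  have "((\<lambda>x. (2 * real m + 3) * ?f m x - (real m + 3) * ?f (Suc m) x)
      has_integral ?F (pi/2) - ?F 0) {0..pi/2}"
  proof (rule fundamental_theorem_of_calculus)
    fix x :: real
    have 1: "(?F has_real_derivative
        3 * (sin x)\<^sup>2 * cos x * (1 - cos x) ^ m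
          + (sin x) ^ 3 * (real m * (1 - cos x) ^ (m - 1) * sin x)) (at x within {0..pi/2})"
      by (auto intro!: derivative_eq_intros simp: algebra_simps)
    have "(sin x) ^ 3 * (real m * (1 - cos x) ^ (m - 1) * sin x)
        = real m * ((sin x)\<^sup>2 * (sin x)\<^sup>2 * (1 - cos x) ^ (m - 1))"
      by (simp add: eval_nat_numeral algebra_simps)
    also have "(sin x)\<^sup>2 * (sin x)\<^sup>2 = (sin x)\<^sup>2 * ((1 + cos x) * (1 - cos x))"
      unfolding mult_cancel_left by (simp add: sin_squared_eq power2_eq_square algebra_simps)
    \<comment> \<open>For \<open>m = 0\<close> the truncated exponent \<open>m - 1\<close> does no
      harm, since the factor \<open>real m\<close> vanishes.\<close>
    also have "real m * (\<dots> * (1 - cos x) ^ (m - 1))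
        = real m * (sin x)\<^sup>2 * (1 + cos x) * (1 - cos x) ^ m"
      by (cases m) (simp_all add: algebra_simps)
    \<comment> \<open>With \<open>cos x = 1 - (1 - cos x)\<close>, the factor
      \<open>3 * cos x + m * (1 + cos x)\<close> becomes
      \<open>(2 * m + 3) - (m + 3) * (1 - cos x)\<close>.\<close>
    finally have "3 * (sin x)\<^sup>2 * cos x * (1 - cos x) ^ m
          + (sin x) ^ 3 * (real m * (1 - cos x) ^ (m - 1) * sin x)
        = (2 * real m + 3) * ?f m x - (real m + 3) * ?f (Suc m) x"
      by (simp add: algebra_simps)
    with 1 show "(?F has_vector_derivative
        (2 * real m + 3) * ?f m x - (real m + 3) * ?f (Suc m) x) (at x within {0..pi/2})"
      by (simp add: has_real_derivative_iff_has_vector_derivative)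
  qed simp
  moreover have "((\<lambda>x. (2 * real m + 3) * ?f m x - (real m + 3) * ?f (Suc m) x)
      has_integral (2 * real m + 3) * sin_cos_moment m
        - (real m + 3) * sin_cos_moment (Suc m)) {0..pi/2}"
    unfolding sin_cos_moment_def
    by (intro has_integral_diff has_integral_mult_right integrable_integral
        sin_cos_moment_integrable)
  \<comment> \<open>The boundary values are 1 and 0; their difference is the constant term of the
    recurrence.\<close>
  ultimately have "?F (pi/2) - ?F 0 =
      (2 * real m + 3) * sin_cos_moment m - (real m + 3) * sin_cos_moment (Suc m)"
    by (rule has_integral_unique)
  then show ?thesis
    by simp
qed

text \<open>The index \<open>m\<close> is that of the convergent minus 2, and the factor
  \<open>(- 1) ^ m * fact (m + 2)\<close> is divided out.\<close>

definition minimal_solution :: "nat \<Rightarrow> real" where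
  "minimal_solution m = (((real m)\<^sup>2 + 5 * real m + 5) * sin_cos_moment m - (real m + 4)) / 2"

text \<open>Expressing both later moments through \<open>sin_cos_moment m\<close> leaves a rational
  identity in \<open>m\<close>. The limiting characteristic polynomial t^2 - 3t + 2 has roots 1 and
  2; polynomial growth belongs to the root 1.\<close>

lemma minimal_solution_rec:
  "(real m + 4) * minimal_solution (Suc (Suc m))
    = (3 * real m + 10) * minimal_solution (Suc m) - (2 * real m + 3) * minimal_solution m"
proof -
  define x where "x = real m"
  have x: "x \<ge> 0" by (simp add: x_def)
  have 1: "sin_cos_moment (Suc m) = ((2 * x + 3) * sin_cos_moment m - 1) / (x + 3)"
    using sin_cos_moment_Suc[of m] x by (simp add: x_def field_simps)
  have 2: "sin_cos_moment (Suc (Suc m)) = ((2 * x + 5) * sin_cos_moment (Suc m) - 1) / (x + 4)"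
    using sin_cos_moment_Suc[of "Suc m"] x by (simp add: x_def field_simps)
  show ?thesis
    unfolding minimal_solution_def 2 unfolding 1 of_nat_Suc x_def[symmetric]
    using x by (simp add: divide_simps) (simp add: algebra_simps power2_eq_square)
qed

lemma abs_minimal_solution_le: "\<bar>minimal_solution m\<bar> \<le> (real m)\<^sup>2 + 6 * real m + 9"
proof -
  have "((real m)\<^sup>2 + 5 * real m + 5) * sin_cos_moment m \<le> ((real m)\<^sup>2 + 5 * real m + 5) * 2"
    by (intro mult_left_mono sin_cos_moment_le_2) auto
  moreover have "0 \<le> ((real m)\<^sup>2 + 5 * real m + 5) * sin_cos_moment m"
    by (intro mult_nonneg_nonneg sin_cos_moment_nonneg) auto
  ultimately show ?thesis
    unfolding minimal_solution_def abs_le_iff by (auto simp: field_simps)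
qed

text \<open>Dividing by sign and factorial turns \<open>rec\<close> into
  \<open>minimal_solution_rec\<close>, so agreement at two consecutive indices suffices.\<close>

lemma recurrence_eq_minimal_solution:
  fixes u :: "nat \<Rightarrow> real"
  assumes rec: "\<And>n. u (Suc (Suc n)) =
      - (3 * real n + 4) * u (Suc n) - (real n + 1) * (2 * real n - 1) * u n"
    and "u 0 = pi / 4" and "u (Suc 0) = 1 - pi / 4"
  shows "u (m + 2) = (- 1) ^ m * fact (m + 2) * minimal_solution m"
proof (induction m rule: induct_nat_012)
  case 0
  show ?case
    using rec[of 0] assms(2,3)
    by (simp add: minimal_solution_def sin_cos_moment_0 eval_nat_numeral algebra_simps)
next
  case 1
  have "sin_cos_moment (Suc 0) = pi / 4 - 1 / 3"
    using sin_cos_moment_Suc[of 0] by (simp add: sin_cos_moment_0 field_simps)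
  then show ?case
    using rec[of 0] rec[of 1] assms(2,3)
    by (simp add: minimal_solution_def eval_nat_numeral algebra_simps)
next
  case (ge2 m)
  define F :: real where "F = (- 1) ^ m * fact (m + 2)"
  have "u (Suc (Suc m) + 2) =
      - (3 * real m + 10) * u (Suc m + 2) - (real m + 3) * (2 * real m + 3) * u (m + 2)"
    using rec[of "m + 2"] by (simp add: algebra_simps)
  also have "u (m + 2) = F * minimal_solution m"
    using ge2 by (simp add: F_def)
  also have "u (Suc m + 2) = - (F * (real m + 3) * minimal_solution (Suc m))"
    using ge2 by (simp add: F_def algebra_simps)
  also have "- (3 * real m + 10) * (- (F * (real m + 3) * minimal_solution (Suc m)))
        - (real m + 3) * (2 * real m + 3) * (F * minimal_solution m)
      = F * (real m + 3) *
        ((3 * real m + 10) * minimal_solution (Suc m) - (2 * real m + 3) * minimal_solution m)"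
    by (simp add: algebra_simps)
  also have "\<dots> = F * (real m + 3) * ((real m + 4) * minimal_solution (Suc (Suc m)))"
    by (simp add: minimal_solution_rec)
  also have "\<dots> = (- 1) ^ Suc (Suc m) * fact (Suc (Suc m) + 2) * minimal_solution (Suc (Suc m))"
    by (simp add: F_def algebra_simps)
  finally show ?case .
qed

lemma recurrence_lower_bound:
  fixes v :: "nat \<Rightarrow> real"
  assumes rec: "\<And>n. v (Suc (Suc n)) =
      (3 * real n + 4) * v (Suc n) - (real n + 1) * (2 * real n - 1) * v n"
    and "v 0 = 1" and "v (Suc 0) = 1"
  shows "fact (m + 2) * (3/2) ^ m \<le> v (m + 2)"
proof -
  have v2: "v 2 = 5"
    using rec[of 0] assms(2,3) by (simp add: eval_nat_numeral)
  \<comment> \<open>A ratio bound \<open>c * (n + 2)\<close> can propagate for large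
    \<open>n\<close> only if c^2 - 3c + 2 \<le> 0, that is 1 \<le> c \<le> 2; here c = 3/2. Starting
    at \<open>v 1\<close> means the induction uses \<open>rec\<close> only where
    \<open>2 * n - 1\<close> is positive.\<close>
  have step: "0 < v (n + 1) \<and> 3 / 2 * (real n + 2) * v (n + 1) \<le> v (n + 2)" for n
  proof (induction n)
    case 0
    show ?case using v2 assms(3) by (simp add: numeral_2_eq_2)
  next
    case (Suc n)
    have pos: "0 < 3 / 2 * (real n + 2) * v (n + 1)"
      using Suc by simp
    with Suc have pos2: "0 < v (n + 2)"
      by linarith
    \<comment> \<open>The induction hypothesis bounds the subtracted term of the recurrence by a
      multiple of \<open>v (n + 2)\<close>.\<close>
    have "(real n + 2) * v (n + 1) * (2 * real n + 1) \<le> 2 / 3 * v (n + 2) * (2 * real n + 1)"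
      using Suc by (intro mult_right_mono) (auto simp: algebra_simps)
    moreover have "v (n + 3) = (3 * real n + 7) * v (n + 2)
        - (real n + 2) * v (n + 1) * (2 * real n + 1)"
      using rec[of "n + 1"] by (simp add: eval_nat_numeral algebra_simps)
    moreover have "3 / 2 * (real n + 3) * v (n + 2) \<le>
        (3 * real n + 7) * v (n + 2) - 2 / 3 * v (n + 2) * (2 * real n + 1)"
    proof -
      \<comment> \<open>This is exactly the right side minus the left side of the claim.\<close>
      have "0 \<le> (real n / 6 + 11 / 6) * v (n + 2)"
        using pos2 by simp
      then show ?thesis by (simp add: field_simps)
    qed
    ultimately have "3 / 2 * (real n + 3) * v (n + 2) \<le> v (n + 3)"
      by linarith
    then show ?case
      using pos2 by (simp add: eval_nat_numeral algebra_simps)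
  qed
  show ?thesis
  proof (induction m)
    case 0
    show ?case using v2 by (simp add: eval_nat_numeral)
  next
    case (Suc m)
    have "fact (Suc m + 2) * (3/2) ^ Suc m
        = 3 / 2 * (real m + 3) * (fact (m + 2) * (3/2) ^ m)"
      by (simp add: field_simps)
    also have "\<dots> \<le> 3 / 2 * (real m + 3) * v (m + 2)"
      by (intro mult_left_mono Suc) auto
    also have "\<dots> \<le> v (Suc m + 2)"
      using step[of "m + 1"] by (simp add: algebra_simps)
    finally show ?case .
  qed
qed

theorem theorem1p1:
  fixes a b :: "nat \<Rightarrow> real"
  assumes "\<And>n. n \<ge> 1 \<Longrightarrow> b n = - (3 * real n - 2)"
    and "a 1 = 1" and "a 2 = 1"
    and "\<And>n. n \<ge> 3 \<Longrightarrow> a n = - ((real n - 1) * (2 * real n - 5))"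
  shows "gcf_has_value a b (- pi / 4)"
proof -
  let ?p = "gcf_num a b" and ?q = "gcf_den a b"
  have b: "b (Suc (Suc n)) = - (3 * real n + 4)" for n
    by (simp add: assms(1))
  have b1: "b (Suc 0) = - 1"
    by (simp add: assms(1))
  \<comment> \<open>The formula for indices from 3 on also yields \<open>a 2 = 1\<close>, so one
    recurrence holds from index 2 on.\<close>
  have a: "a (Suc (Suc n)) = - (real n + 1) * (2 * real n - 1)" for n
  proof (cases n)
    case 0
    then show ?thesis using assms(3) by (simp add: eval_nat_numeral)
  next
    case (Suc k)
    then show ?thesis by (simp add: assms(4) algebra_simps)
  qed
  have u: "?p (m + 2) + pi / 4 * ?q (m + 2) = (- 1) ^ m * fact (m + 2) * minimal_solution m" for m
    by (rule recurrence_eq_minimal_solution)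
      (use assms(2) in \<open>simp_all add: a b b1 field_simps\<close>)
  \<comment> \<open>The denominators alternate in sign; the factor \<open>(- 1) ^ n\<close> makes
    them positive.\<close>
  have v: "fact (m + 2) * (3/2) ^ m \<le> (- 1) ^ (m + 2) * ?q (m + 2)" for m
    by (rule recurrence_lower_bound) (simp_all add: a b b1 algebra_simps)
  have q_large: "fact (m + 2) * (3/2) ^ m \<le> \<bar>?q (m + 2)\<bar>" for m
    using order_trans[OF v abs_ge_self] by (simp add: abs_mult)
  have q_nz: "?q (m + 2) \<noteq> 0" for m
  proof -
    have "(0::real) < fact (m + 2) * (3/2) ^ m"
      by simp
    with q_large[of m] have "0 < \<bar>?q (m + 2)\<bar>"
      by linarith
    then show ?thesis
      by (simp only: zero_less_abs_iff not_False_eq_True)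
  qed
  have bound: "norm (?p (m + 2) / ?q (m + 2) - - pi / 4)
      \<le> ((real m)\<^sup>2 + 6 * real m + 9) / (3/2) ^ m" for m
  proof -
    \<comment> \<open>The error of the convergent is the minimal solution over the dominant one; the
      factorials cancel.\<close>
    have "?p (m + 2) / ?q (m + 2) - - pi / 4
        = (?p (m + 2) + pi / 4 * ?q (m + 2)) / ?q (m + 2)"
      using q_nz[of m] by (simp add: field_simps)
    then have "norm (?p (m + 2) / ?q (m + 2) - - pi / 4)
        = fact (m + 2) * \<bar>minimal_solution m\<bar> / \<bar>?q (m + 2)\<bar>"
      unfolding u by (simp add: abs_mult del: fact_Suc add_2_eq_Suc')
    also have "\<dots> \<le> fact (m + 2) * ((real m)\<^sup>2 + 6 * real m + 9) / (fact (m + 2) * (3/2) ^ m)"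
      by (intro frac_le mult_left_mono abs_minimal_solution_le q_large) auto
    also have "\<dots> = ((real m)\<^sup>2 + 6 * real m + 9) / (3/2) ^ m"
      by (simp del: fact_Suc add_2_eq_Suc')
    finally show ?thesis .
  qed
  have "(\<lambda>m. ((real m)\<^sup>2 + 6 * real m + 9) / (3/2) ^ m) \<longlonglongrightarrow> 0"
    by real_asymp
  then have "(\<lambda>m. ?p (m + 2) / ?q (m + 2) - - pi / 4) \<longlonglongrightarrow> 0"
    by (rule Lim_null_comparison[OF always_eventually[OF allI[OF bound]]])
  then have "(\<lambda>m. ?p (m + 2) / ?q (m + 2)) \<longlonglongrightarrow> - pi / 4"
    by (rule Lim_null[THEN iffD2])
  then have "(\<lambda>n. ?p n / ?q n) \<longlonglongrightarrow> - pi / 4"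
    by (rule LIMSEQ_offset)
  moreover have "\<forall>\<^sub>F n in sequentially. ?q n \<noteq> 0"
    using q_nz by (intro eventually_sequentiallyI[of 2]) (metis le_add_diff_inverse2)
  ultimately show ?thesis
    by (simp add: gcf_has_value_def)
qed

end
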